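(* Let $W$ be the set of states of a world containing an agent with action set $A$, and let $\sim$ be the equivalence relation on $A$ given by $a\sim a'$ iff $a*w=a'*w$ for all $w\in W$. Suppose that (1) (unrestricted actions) $a*w$ is defined for all $a\in A$ and all $w\in W$; and (2) (inverse actions) for each $a\in A/\sim$ there exists $a'\in A/\sim$ such that $(a'\circ a)*w=w$ and $(a\circ a')*w=w$ for all $w\in W$. Then $*:(A/\sim)\times W\to W$ is a left group action (of the group $(A/\sim,\circ)$ on $W$).
   Context: A world is a directed multigraph $(W,\hat D,s,t)$ with vertex set $W$ (world states), arrow set $\hat D$ and source and target maps $s,t:\hat D\to W$; for each $w\in W$ there is a distinguished trivial arrow $1_w\in\hat D$ with $s(1_w)=t(1_w)=w$. $D$ is the set of all paths $\hat d_n\circ\cdots\circ\hat d_1$ ($n\ge 1$, $t(\hat d_i)=s(\hat d_{i+1})$), with $s,t$ extended to paths by taking the source of the first arrow and the target of the last. Agent and actions. There is a set $\hat A$ (minimum actions); $A$ is the set of all nonempty finite sequences of elements of $\hat A$, and $\circ$ on $A$ is concatenation, with $a'\circ a$ meaning "first $a$, then $a'$". There is a subset $\hat D_A\subset D$ (minimum action transitions) with $1_w\in\hat D_A$ for all $w\in W$, and a labelling map $\hat l:\hat D_A\to\hat A$ such that: (i) if $d\ne d'$ in $\hat D_A$ have $s(d)=s(d')$ then $\hat l(d)\neq\hat l(d')$; (ii) there is an element $1\in\hat A$ (the identity action) with $\hat l(1_w)=1$ for all $w\in W$. $D_A$ is the set of all nonempty paths in the multigraph with vertices $W$ and arrows $\hat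 D_A$; the labelling extends to $l:D_A\to A$ by $l(d_n\circ\cdots\circ d_1)=\hat l(d_n)\cdots\hat l(d_1)$. Standing assumption: every world state transition is due to the agent, i.e. $D=D_A$ (every path in $D$ is a composite of minimum action transitions). Effect of actions. For $a\in A$, $w\in W$: if there is $d\in D_A$ with $s(d)=w$ and $l(d)=a$, then $a*w=t(d)$ (unambiguous by (i)); otherwise $a*w$ is undefined. The equality $a*w=a'*w$ means that either both sides are undefined, or both are defined and equal. $[a]_\sim$ denotes the class of $a$; composition on $A/\sim$ is the (well-defined) operation $[a']_\sim\circ[a]_\sim=[a'\circ a]_\sim$, and the effect of a class on a state is $[a]_\sim*w=a*w$ (undefined if $a*w$ is undefined). *)

theory Defs
  imports "Graph_Theory.Arc_Walk" "HOL-Algebra.Group_Action"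
begin

text \<open>
  Paths and words are lists in chronological order: the composite \<open>d\<^sub>n \<circ> \<dots> \<circ> d\<^sub>1\<close> is the
  list \<open>[d\<^sub>1, \<dots>, d\<^sub>n]\<close>, so that \<open>a' \<circ> a\<close> (first \<open>a\<close>, then \<open>a'\<close>) is \<open>a @ a'\<close>.
\<close>

definition paths :: "('w, 'e) pre_digraph \<Rightarrow> 'e list set" where
  "paths G = {p. p \<noteq> [] \<and> (\<exists>u v. pre_digraph.awalk G u p v)}"

definition path_source :: "('w, 'e) pre_digraph \<Rightarrow> 'e list \<Rightarrow> 'w" where
  "path_source G p = tail G (hd p)"

definition path_target :: "('w, 'e) pre_digraph \<Rightarrow> 'e list \<Rightarrow> 'w" where
  "path_target G p = head G (last p)"

record ('w, 'e, 'a) agent_world =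
  dgraph :: "('w, 'e) pre_digraph"
  triv :: "'w \<Rightarrow> 'e"
  min_actions :: "'a set"
  min_transitions :: "'e list set"
  min_label :: "'e list \<Rightarrow> 'a"
  id_action :: 'a

abbreviation states :: "('w, 'e, 'a) agent_world \<Rightarrow> 'w set" where
  "states M \<equiv> verts (dgraph M)"

text \<open>
  The multigraph whose arrows are the minimum action transitions, each of which is itself a path
  of the world. An element of \<open>D\<^sub>A\<close> is a path in this multigraph, hence a list of lists of arrows,
  and \<open>concat\<close> gives the path of the world that it is a decomposition of.
\<close>

definition transition_graph :: "('w, 'e, 'a) agent_world \<Rightarrow> ('w, 'e list) pre_digraph" where
  "transition_graph M =
     \<lparr>verts = states M, arcs = min_transitions M,
      tail = path_source (dgraph M), head = path_target (dgraph M)\<rparr>"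

abbreviation agent_paths :: "('w, 'e, 'a) agent_world \<Rightarrow> 'e list list set" where
  "agent_paths M \<equiv> paths (transition_graph M)"

definition label :: "('w, 'e, 'a) agent_world \<Rightarrow> 'e list list \<Rightarrow> 'a list" where
  "label M d = map (min_label M) d"

locale agent_world =
  fixes M :: "('w, 'e, 'a) agent_world" (structure)
  assumes wf_dgraph: "wf_digraph (dgraph M)"
    and triv_arc: "w \<in> states M \<Longrightarrow> triv M w \<in> arcs (dgraph M)"
    and triv_source: "w \<in> states M \<Longrightarrow> tail (dgraph M) (triv M w) = w"
    and triv_target: "w \<in> states M \<Longrightarrow> head (dgraph M) (triv M w) = w"
    and min_transitions_paths: "min_transitions M \<subseteq> paths (dgraph M)"
    and triv_min_transition: "w \<in> states M \<Longrightarrow> [triv M w] \<in> min_transitions M"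
    and min_label_in: "d \<in> min_transitions M \<Longrightarrow> min_label M d \<in> min_actions M"
    and min_label_distinct:
      "\<lbrakk>d \<in> min_transitions M; d' \<in> min_transitions M; d \<noteq> d';
        path_source (dgraph M) d = path_source (dgraph M) d'\<rbrakk> \<Longrightarrow> min_label M d \<noteq> min_label M d'"
    and id_action_in: "id_action M \<in> min_actions M"
    and min_label_triv: "w \<in> states M \<Longrightarrow> min_label M [triv M w] = id_action M"
    and all_transitions_agent: "paths (dgraph M) = concat ` agent_paths M"

definition actions :: "('w, 'e, 'a) agent_world \<Rightarrow> 'a list set" where
  "actions M = {a. a \<noteq> [] \<and> set a \<subseteq> min_actions M}"

definition act_comp :: "'a list \<Rightarrow> 'a list \<Rightarrow> 'a list" where
  "act_comp a' a = a @ a'"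

text \<open>\<open>None\<close> stands for ``undefined'', so that equality of options is the equality of effects.\<close>

definition effect :: "('w, 'e, 'a) agent_world \<Rightarrow> 'a list \<Rightarrow> 'w \<Rightarrow> 'w option" where
  "effect M a w =
     (if \<exists>d \<in> agent_paths M. path_source (transition_graph M) d = w \<and> label M d = a
      then Some (THE v. \<exists>d \<in> agent_paths M. path_source (transition_graph M) d = w \<and>
                   label M d = a \<and> path_target (transition_graph M) d = v)
      else None)"

definition act_equiv :: "('w, 'e, 'a) agent_world \<Rightarrow> ('a list \<times> 'a list) set" where
  "act_equiv M = {(a, a'). a \<in> actions M \<and> a' \<in> actions M \<and>
     (\<forall>w \<in> states M. effect M a w = effect M a' w)}"

abbreviation act_classes :: "('w, 'e, 'a) agent_world \<Rightarrow> 'a list set set" where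
  "act_classes M \<equiv> actions M // act_equiv M"

definition class_comp ::
    "('w, 'e, 'a) agent_world \<Rightarrow> 'a list set \<Rightarrow> 'a list set \<Rightarrow> 'a list set" where
  "class_comp M X' X = (\<Union>a' \<in> X'. \<Union>a \<in> X. act_equiv M `` {act_comp a' a})"

definition class_effect ::
    "('w, 'e, 'a) agent_world \<Rightarrow> 'a list set \<Rightarrow> 'w \<Rightarrow> 'w option" where
  "class_effect M X w = the_elem ((\<lambda>a. effect M a w) ` X)"

definition class_monoid :: "('w, 'e, 'a) agent_world \<Rightarrow> 'a list set monoid" where
  "class_monoid M =
     \<lparr>carrier = act_classes M, mult = class_comp M, one = act_equiv M `` {[id_action M]}\<rparr>"

text \<open>
  The library's group actions are homomorphisms into \<open>BijGroup\<close>, whose elements are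
  extensional functions; hence the restriction to the states.
\<close>

definition class_action :: "('w, 'e, 'a) agent_world \<Rightarrow> 'a list set \<Rightarrow> 'w \<Rightarrow> 'w" where
  "class_action M X = (\<lambda>w \<in> states M. the (class_effect M X w))"

lemma equiv_act_equiv: "equiv (actions M) (act_equiv M)"
  by (rule equivI) (auto simp: act_equiv_def refl_on_def sym_def trans_def)

context agent_world
begin

lemma agent_path_unique:
  assumes "pre_digraph.awalk (transition_graph M) u d v"
    and "pre_digraph.awalk (transition_graph M) u d' v'"
    and "label M d = label M d'"
  shows "d = d'"
  using assms
proof (induction d arbitrary: u d')
  case Nil
  then show ?case by (simp add: label_def)
next
  case (Cons e d)
  then obtain e' d'' where d': "d' = e' # d''"
    by (auto simp: label_def Cons_eq_map_conv)
  have "e = e'"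
    using Cons.prems min_label_distinct[of e e'] unfolding d'
    by (auto simp: label_def pre_digraph.awalk_def pre_digraph.cas.simps transition_graph_def)
  moreover have "head (transition_graph M) e \<in> verts (transition_graph M)"
    if "e \<in> min_transitions M"
  proof -
    interpret wf_digraph "dgraph M" by (rule wf_dgraph)
    show ?thesis
      using that min_transitions_paths
      by (auto simp: transition_graph_def path_target_def paths_def awalk_def
          intro!: head_in_verts intro: last_in_set)
  qed
  ultimately have "d = d''"
    using Cons.prems unfolding d'
    by (intro Cons.IH[of "head (transition_graph M) e"])
      (auto simp: label_def pre_digraph.awalk_def pre_digraph.cas.simps transition_graph_def)
  then show ?case
    using \<open>e = e'\<close> d' by simp
qed

lemma effect_eqI:
  assumes d: "d \<in> agent_paths M"
  shows "effect M (label M d) (path_source (transition_graph M) d) =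
    Some (path_target (transition_graph M) d)"
proof -
  have walk: "\<exists>v. pre_digraph.awalk (transition_graph M) (path_source (transition_graph M) p) p v"
    if "p \<in> agent_paths M" for p
  proof -
    from that obtain u v where "p \<noteq> []" "pre_digraph.awalk (transition_graph M) u p v"
      by (auto simp: paths_def)
    then show ?thesis
      by (cases p)
        (auto simp: path_source_def pre_digraph.awalk_def pre_digraph.cas.simps)
  qed
  have "d' = d"
    if "d' \<in> agent_paths M" "label M d' = label M d"
      "path_source (transition_graph M) d' = path_source (transition_graph M) d" for d'
    using walk[OF d] walk[OF that(1)] that agent_path_unique by metis
  then have "(THE v. \<exists>d' \<in> agent_paths M.
      path_source (transition_graph M) d' = path_source (transition_graph M) d \<and>
      label M d' = label M d \<and> path_target (transition_graph M) d' = v) =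
    path_target (transition_graph M) d"
    using d by (intro the_equality) auto
  then show ?thesis
    using d by (auto simp: effect_def)
qed

lemma class_effect_class:
  assumes "a \<in> actions M" "w \<in> states M"
  shows "class_effect M (act_equiv M `` {a}) w = effect M a w"
proof -
  have "(\<lambda>b. effect M b w) ` (act_equiv M `` {a}) = {effect M a w}"
    using assms by (auto simp: act_equiv_def image_iff)
  then show ?thesis
    by (simp add: class_effect_def)
qed

end

end

theory Submission
  imports Defs
begin

text \<open>A word \<open>a\<close> sends \<open>w\<close> to \<open>v\<close> exactly when a
  nonempty walk from \<open>w\<close> to \<open>v\<close> in the transition graph carries the label
  \<open>a\<close> (\<open>effect_eq_Some_iff\<close>). Cutting and joining walks shows that the
  effect of a composite is the composite of the partial effects (\<open>effect_act_comp\<close>),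
  and the trivial loops make the identity word fix every state (\<open>effect_id_action\<close>). So
  composition descends to classes (\<open>class_comp_class\<close>). A class is determined by its
  effect on all states, so the unit and inverse laws of the quotient are checked on effects, while
  associativity comes from appending words (\<open>group_class_monoid\<close>). Hypothesis (1) turns
  each class into a map from the states to themselves, (2) supplies the inverse map, and the
  composition law makes this a homomorphism into the group of bijections.\<close>

lemma cas_path_source_target:
  assumes "pre_digraph.cas G u p v" "p \<noteq> []"
  shows "u = path_source G p" "v = path_target G p"
proof -
  show "u = path_source G p"
    using assms by (cases p) (auto simp: path_source_def pre_digraph.cas.simps)
  show "v = path_target G p"
    using assms
    by (induction p arbitrary: u) (auto simp: path_target_def pre_digraph.cas.simps)
qed

context agent_world
begin

lemma wf_transition_graph: "wf_digraph (transition_graph M)"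
proof
  interpret wf_digraph "dgraph M" by (rule wf_dgraph)
  fix e assume "e \<in> arcs (transition_graph M)"
  then have "e \<noteq> []" "set e \<subseteq> arcs (dgraph M)"
    using min_transitions_paths by (auto simp: transition_graph_def paths_def awalk_def)
  then show "tail (transition_graph M) e \<in> verts (transition_graph M)"
    "head (transition_graph M) e \<in> verts (transition_graph M)"
    by (auto simp: transition_graph_def path_source_def path_target_def
        intro!: tail_in_verts head_in_verts)
qed

text \<open>Replaces the definite description in \<open>effect\<close> by mere existence of a walk;
  uniqueness of the labelled path enters through \<open>effect_eqI\<close>.\<close>

lemma effect_eq_Some_iff:
  "effect M a w = Some v \<longleftrightarrow>
    (\<exists>d. d \<noteq> [] \<and> pre_digraph.awalk (transition_graph M) w d v \<and> label M d = a)"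
proof
  assume eff: "effect M a w = Some v"
  then obtain d where d: "d \<in> agent_paths M" "path_source (transition_graph M) d = w"
    "label M d = a"
    by (auto simp: effect_def split: if_splits)
  then have "path_target (transition_graph M) d = v"
    using effect_eqI[OF d(1)] eff by simp
  with d show "\<exists>d. d \<noteq> [] \<and> pre_digraph.awalk (transition_graph M) w d v \<and> label M d = a"
    by (auto simp: paths_def pre_digraph.awalk_def dest: cas_path_source_target)
next
  assume "\<exists>d. d \<noteq> [] \<and> pre_digraph.awalk (transition_graph M) w d v \<and> label M d = a"
  then obtain d where d: "d \<noteq> []" "pre_digraph.awalk (transition_graph M) w d v" "label M d = a"
    by blast
  then have "d \<in> agent_paths M"
    by (auto simp: paths_def)
  moreover have "w = path_source (transition_graph M) d" "v = path_target (transition_graph M) d"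
    using d cas_path_source_target by (auto simp: pre_digraph.awalk_def)
  ultimately show "effect M a w = Some v"
    using effect_eqI d(3) by blast
qed

lemma effect_in_states: "effect M a w = Some v \<Longrightarrow> v \<in> states M"
  using wf_digraph.awalk_last_in_verts[OF wf_transition_graph]
  by (auto simp: effect_eq_Some_iff transition_graph_def)

text \<open>Labels are read off arrow by arrow, so a walk labelled \<open>a @ a'\<close> can be cut
  where \<open>a\<close> ends. \<open>Option.bind\<close> makes the composite undefined as soon as
  either stage is.\<close>

lemma effect_act_comp:
  assumes "a \<noteq> []" "a' \<noteq> []"
  shows "effect M (act_comp a' a) w = Option.bind (effect M a w) (effect M a')"
proof -
  interpret T: wf_digraph "transition_graph M" by (rule wf_transition_graph)
  \<comment> \<open>Two options that equal \<open>Some v\<close> for the same values v are equal, so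
    the undefined case needs no separate treatment.\<close>
  have "effect M (act_comp a' a) w = Some v \<longleftrightarrow>
      (\<exists>u. effect M a w = Some u \<and> effect M a' u = Some v)" for v
  proof
    assume "effect M (act_comp a' a) w = Some v"
    then obtain p where p: "T.awalk w p v" "label M p = a @ a'"
      by (auto simp: effect_eq_Some_iff act_comp_def)
    then obtain d d' where "p = d @ d'" "label M d = a" "label M d' = a'"
      by (auto simp: label_def map_eq_append_conv)
    with p(1) have "T.awalk w (d @ d') v" "label M d = a" "label M d' = a'"
      by simp_all
    \<comment> \<open>\<open>effect\<close> counts nonempty walks only, so neither half of the cut
      may be empty.\<close>
    moreover from this assms have "d \<noteq> []" "d' \<noteq> []"
      by (auto simp: label_def)
    ultimately show "\<exists>u. effect M a w = Some u \<and> effect M a' u = Some v"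
      unfolding effect_eq_Some_iff T.awalk_append_iff by blast
  next
    assume "\<exists>u. effect M a w = Some u \<and> effect M a' u = Some v"
    then show "effect M (act_comp a' a) w = Some v"
      unfolding effect_eq_Some_iff act_comp_def label_def
      by (metis T.awalk_appendI append_is_Nil_conv map_append)
  qed
  then have "effect M (act_comp a' a) w = Some v \<longleftrightarrow>
      Option.bind (effect M a w) (effect M a') = Some v" for v
    by (simp add: bind_eq_Some_conv)
  then show ?thesis
    by (metis not_Some_eq)
qed

lemma effect_id_action:
  assumes "w \<in> states M"
  shows "effect M [id_action M] w = Some w"
proof -
  interpret T: wf_digraph "transition_graph M" by (rule wf_transition_graph)
  \<comment> \<open>The trivial arrow is a one-arrow path of the world, and that path is in turn a
    single arrow of the transition graph.\<close>
  have "T.awalk w [[triv M w]] w"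
    using assms triv_min_transition triv_source triv_target
    unfolding T.awalk_def
    by simp
      (simp add: transition_graph_def path_source_def path_target_def)
  then show ?thesis
    using assms min_label_triv unfolding effect_eq_Some_iff
    by (intro exI[of _ "[[triv M w]]"]) (simp add: label_def)
qed

lemma id_action_actions: "[id_action M] \<in> actions M"
  using id_action_in by (simp add: actions_def)

lemma act_comp_actions: "a \<in> actions M \<Longrightarrow> a' \<in> actions M \<Longrightarrow> act_comp a' a \<in> actions M"
  by (auto simp: actions_def act_comp_def)

lemma act_class_eqI:
  assumes "a \<in> actions M" "b \<in> actions M"
    and "\<And>w. w \<in> states M \<Longrightarrow> effect M a w = effect M b w"
  shows "act_equiv M `` {a} = act_equiv M `` {b}"
  using assms by (intro equiv_class_eq[OF equiv_act_equiv]) (simp add: act_equiv_def)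

text \<open>This is well-definedness: \<open>class_comp\<close> is a union over all representatives,
  and the classes in that union coincide. Equivalent words reach the same state, which again lies in
  \<open>states M\<close>, where the second pair of words agrees.\<close>

lemma class_comp_class:
  assumes a: "a \<in> actions M" and a': "a' \<in> actions M"
  shows "class_comp M (act_equiv M `` {a'}) (act_equiv M `` {a}) = act_equiv M `` {act_comp a' a}"
proof -
  have "act_equiv M `` {act_comp b' b} = act_equiv M `` {act_comp a' a}"
    if "(a', b') \<in> act_equiv M" "(a, b) \<in> act_equiv M" for b b'
  proof (rule act_class_eqI)
    fix w assume w: "w \<in> states M"
    have "b \<noteq> []" "b' \<noteq> []" "a \<noteq> []" "a' \<noteq> []"
      using that by (auto simp: act_equiv_def actions_def)
    with w show "effect M (act_comp b' b) w = effect M (act_comp a' a) w"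
      using that effect_in_states
      by (cases "effect M a w") (auto simp: effect_act_comp act_equiv_def)
  qed (use that act_comp_actions in \<open>auto simp: act_equiv_def\<close>)
  moreover have "(a, a) \<in> act_equiv M" "(a', a') \<in> act_equiv M"
    using a a' by (auto simp: act_equiv_def)
  ultimately show ?thesis
    unfolding class_comp_def by blast
qed

lemma class_comp_assoc:
  assumes "a \<in> actions M" "b \<in> actions M" "c \<in> actions M"
  shows "class_comp M (class_comp M (act_equiv M `` {c}) (act_equiv M `` {b})) (act_equiv M `` {a}) =
    class_comp M (act_equiv M `` {c}) (class_comp M (act_equiv M `` {b}) (act_equiv M `` {a}))"
  using assms by (simp add: class_comp_class act_comp_actions) (simp add: act_comp_def)

text \<open>\<open>groupI\<close> asks for a left unit and left inverses, hence the one-sided form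
  of the assumption.\<close>

lemma group_class_monoid:
  assumes inverses: "\<And>X. X \<in> act_classes M \<Longrightarrow> \<exists>X' \<in> act_classes M. \<forall>w \<in> states M.
      class_effect M (class_comp M X' X) w = Some w"
  shows "group (class_monoid M)"
proof (rule groupI)
  let ?c = "\<lambda>a. act_equiv M `` {a}"
  show "\<one>\<^bsub>class_monoid M\<^esub> \<in> carrier (class_monoid M)"
    using id_action_actions by (simp add: class_monoid_def quotientI)
  fix X assume "X \<in> carrier (class_monoid M)"
  then obtain a where a: "a \<in> actions M" and X: "X = ?c a"
    by (auto simp: class_monoid_def elim: quotientE)
  have "?c (act_comp [id_action M] a) = ?c a"
  proof (rule act_class_eqI)
    fix w assume "w \<in> states M"
    then show "effect M (act_comp [id_action M] a) w = effect M a w"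
      using a effect_in_states
      by (cases "effect M a w") (auto simp: effect_act_comp actions_def effect_id_action)
  qed (use a id_action_actions act_comp_actions in auto)
  then show "\<one>\<^bsub>class_monoid M\<^esub> \<otimes>\<^bsub>class_monoid M\<^esub> X = X"
    using a id_action_actions by (simp add: X class_monoid_def class_comp_class)
  obtain b where b: "b \<in> actions M"
    and inv: "\<forall>w \<in> states M. class_effect M (class_comp M (?c b) (?c a)) w = Some w"
    using inverses[of "?c a"] a by (auto simp: quotientI elim!: quotientE)
  \<comment> \<open>Both words fix every state, so they are equivalent.\<close>
  have "?c (act_comp b a) = ?c [id_action M]"
    using inv a b
    by (intro act_class_eqI)
      (auto simp: class_comp_class class_effect_class act_comp_actions id_action_actions
        effect_id_action)
  then show "\<exists>Y \<in> carrier (class_monoid M). Y \<otimes>\<^bsub>class_monoid M\<^esub> X = \<one>\<^bsub>class_monoid M\<^esub>"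
    using a b by (auto simp: X class_monoid_def class_comp_class quotientI intro!: bexI[of _ "?c b"])
next
  fix X Y assume "X \<in> carrier (class_monoid M)" "Y \<in> carrier (class_monoid M)"
  then show "X \<otimes>\<^bsub>class_monoid M\<^esub> Y \<in> carrier (class_monoid M)"
    by (auto simp: class_monoid_def class_comp_class act_comp_actions quotientI elim!: quotientE)
next
  fix X Y Z
  assume "X \<in> carrier (class_monoid M)" "Y \<in> carrier (class_monoid M)"
    "Z \<in> carrier (class_monoid M)"
  then show "X \<otimes>\<^bsub>class_monoid M\<^esub> Y \<otimes>\<^bsub>class_monoid M\<^esub> Z =
      X \<otimes>\<^bsub>class_monoid M\<^esub> (Y \<otimes>\<^bsub>class_monoid M\<^esub> Z)"
    by (auto simp: class_monoid_def class_comp_assoc elim!: quotientE)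
qed

lemma class_effect_defined:
  assumes "\<forall>a \<in> actions M. \<forall>w \<in> states M. effect M a w \<noteq> None"
    and "X \<in> act_classes M" "w \<in> states M"
  shows "\<exists>w' \<in> states M. class_effect M X w = Some w'"
  using assms effect_in_states by (fastforce simp: class_effect_class elim!: quotientE)

text \<open>The action law for classes, obtained from \<open>effect_act_comp\<close> on
  representatives.\<close>

lemma class_effect_comp:
  assumes "X \<in> act_classes M" "Y \<in> act_classes M" "w \<in> states M"
    and "class_effect M Y w = Some u"
  shows "class_effect M (class_comp M X Y) w = class_effect M X u"
proof -
  obtain a b where ab: "a \<in> actions M" "b \<in> actions M"
    and XY: "X = act_equiv M `` {a}" "Y = act_equiv M `` {b}"
    using assms by (auto elim!: quotientE)
  have "effect M b w = Some u"
    using assms ab by (simp add: XY class_effect_class)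
  moreover from this have "u \<in> states M"
    by (rule effect_in_states)
  ultimately show ?thesis
    using ab assms(3)
    by (simp add: XY class_comp_class class_effect_class act_comp_actions)
      (simp add: effect_act_comp actions_def)
qed

end

theorem proposition7:
  fixes M :: "('w, 'e, 'a) agent_world"
  assumes "agent_world M"
    and unrestricted: "\<forall>a \<in> actions M. \<forall>w \<in> states M. effect M a w \<noteq> None"
    and inverses: "\<forall>X \<in> act_classes M. \<exists>X' \<in> act_classes M. \<forall>w \<in> states M.
          class_effect M (class_comp M X' X) w = Some w \<and>
          class_effect M (class_comp M X X') w = Some w"
  shows "(\<forall>X \<in> act_classes M. \<forall>w \<in> states M. \<exists>w' \<in> states M. class_effect M X w = Some w')
    \<and> group_action (class_monoid M) (states M) (class_action M)"
proof -
  interpret agent_world M by fact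
  let ?f = "class_action M"
  have total: "\<exists>w' \<in> states M. class_effect M X w = Some w'"
    if "X \<in> act_classes M" "w \<in> states M" for X w
    using class_effect_defined[OF unrestricted that] .
  have f_in: "?f X w \<in> states M" if "X \<in> act_classes M" "w \<in> states M" for X w
    using total[OF that] that by (auto simp: class_action_def)
  \<comment> \<open>By \<open>total\<close> the class \<open>Y\<close> has a defined effect at
    \<open>w\<close>, so the \<open>the\<close> inside \<open>?f Y w\<close> yields a genuine
    state.\<close>
  have f_comp: "the (class_effect M (class_comp M X Y) w) = ?f X (?f Y w)"
    if XY: "X \<in> act_classes M" "Y \<in> act_classes M" and w: "w \<in> states M" for X Y w
    using total[OF XY(2) w] class_effect_comp[OF XY w] w by (auto simp: class_action_def)
  have group: "group (class_monoid M)"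
    using inverses by (intro group_class_monoid) blast
  \<comment> \<open>The map of the inverse class is a two-sided inverse of
    \<open>?f X\<close>.\<close>
  have bij: "?f X \<in> Bij (states M)" if X: "X \<in> act_classes M" for X
  proof -
    obtain X' where X': "X' \<in> act_classes M"
      and inv: "\<forall>w \<in> states M. class_effect M (class_comp M X' X) w = Some w \<and>
        class_effect M (class_comp M X X') w = Some w"
      using inverses X by blast
    have "?f X' (?f X w) = w" "?f X (?f X' w) = w" if "w \<in> states M" for w
      using f_comp[OF X' X that] f_comp[OF X X' that] inv that by simp_all
    then have "bij_betw (?f X) (states M) (states M)"
      using f_in X X' by (intro bij_betw_byWitness[where f' = "?f X'"]) auto
    then show ?thesis
      by (simp add: Bij_def class_action_def)
  qed
  have "?f \<in> hom (class_monoid M) (BijGroup (states M))"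
  proof (rule homI)
    fix X Y assume "X \<in> carrier (class_monoid M)" "Y \<in> carrier (class_monoid M)"
    then have XY: "X \<in> act_classes M" "Y \<in> act_classes M"
      by (auto simp: class_monoid_def)
    \<comment> \<open>Both sides are restricted to the states, so pointwise agreement there gives
      equality of functions.\<close>
    have "?f (class_comp M X Y) = compose (states M) (?f X) (?f Y)"
      using f_comp[OF XY] unfolding compose_def class_action_def[of M "class_comp M X Y"]
      by (intro restrict_ext) simp
    then show "?f (X \<otimes>\<^bsub>class_monoid M\<^esub> Y) = ?f X \<otimes>\<^bsub>BijGroup (states M)\<^esub> ?f Y"
      using bij XY by (simp add: class_monoid_def BijGroup_def)
  qed (simp add: class_monoid_def BijGroup_def bij)
  \<comment> \<open>An action is by definition a homomorphism between groups, so the unit law of the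
    action is implied.\<close>
  then have "group_action (class_monoid M) (states M) ?f"
    using group group_BijGroup
    by (simp add: group_action_def group_hom_def group_hom_axioms_def)
  with total show ?thesis
    by blast
qed

end
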